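(* Let $d\ge1$ be an integer, $r_1,r_2\in(0,1)$ and $\nu_1,\nu_2\in\mathbb{R}$. Let $W_1\sim\mathrm{CMB}_d(r_1,\nu_1)$ and $W_2\sim\mathrm{CMB}_d(r_2,\nu_2)$ with $\mathbb{E}[W_1]=\mathbb{E}[W_2]=\mu$ and $\nu_1\le\nu_2$. Let $\boldsymbol{I}^e_1=(I^e_{1,1},\dots,I^e_{1,d})$ and $\boldsymbol{I}^e_2=(I^e_{2,1},\dots,I^e_{2,d})$ be two exchangeable Bernoulli ($\{0,1\}^d$-valued) random vectors such that $\sum_{j=1}^d I^e_{1,j}$ has the same distribution as $W_1$ and $\sum_{j=1}^d I^e_{2,j}$ has the same distribution as $W_2$. Then $\boldsymbol{I}^e_1,\boldsymbol{I}^e_2\in\mathcal{B}_d(p)$ with $p=\mu/d$, and $\boldsymbol{I}^e_2\preceq_{sm}\boldsymbol{I}^e_1$.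
   Context: Conway--Maxwell-binomial distribution: for an integer $d\ge1$, $r\in(0,1)$ and $\nu\in\mathbb{R}$, a random variable $W$ with values in $\{0,\dots,d\}$ has distribution $\mathrm{CMB}_d(r,\nu)$ if $$\mathbb{P}(W=k)=\frac{\binom{d}{k}^{\nu} r^k(1-r)^{d-k}}{S_d(r,\nu)},\quad k\in\{0,\dots,d\},\qquad S_d(r,\nu)=\sum_{k=0}^d\binom{d}{k}^{\nu} r^k(1-r)^{d-k}.$$ Fréchet class: $\mathcal{B}_d(p)$ is the class of $d$-dimensional Bernoulli distributions (distributions on $\{0,1\}^d$) all of whose one-dimensional marginals have mean $p$; $\boldsymbol{I}\in\mathcal{B}_d(p)$ means that the distribution of $\boldsymbol{I}$ belongs to $\mathcal{B}_d(p)$. Supermodular order: a function $\phi:\{0,1\}^d\to\mathbb{R}$ is supermodular if $\phi(\boldsymbol{i})+\phi(\boldsymbol{k})\le\phi(\boldsymbol{i}\wedge\boldsymbol{k})+\phi(\boldsymbol{i}\vee\boldsymbol{k})$ for all $\boldsymbol{i},\boldsymbol{k}\in\{0,1\}^d$, where $\wedge,\vee$ are the componentwise minimum and maximum. For two Bernoulli random vectors $\boldsymbol{I},\boldsymbol{K}$ with distributions in the same Fréchet class, $\boldsymbol{I}\preceq_{sm}\boldsymbol{K}$ means $\mathbb{E}[\phi(\boldsymbol{I})]\le\mathbb{E}[\phi(\boldsymbol{K})]$ for all supermodular $\phi:\{0,1\}^d\to\mathbb{R}$. *)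

theory Defs
  imports "HOL-Probability.Probability" "HOL-Combinatorics.Permutations"
begin

(* The binomial coefficients are positive for k <= d, so powr is the usual
   real power. *)
definition cmb_weight :: "nat \<Rightarrow> real \<Rightarrow> real \<Rightarrow> nat \<Rightarrow> real" where
  "cmb_weight d r \<nu> k = real (d choose k) powr \<nu> * r ^ k * (1 - r) ^ (d - k)"

definition cmb_norm :: "nat \<Rightarrow> real \<Rightarrow> real \<Rightarrow> real" where
  "cmb_norm d r \<nu> = (\<Sum>k = 0..d. cmb_weight d r \<nu> k)"

definition cmb_distributed ::
    "'a measure \<Rightarrow> ('a \<Rightarrow> nat) \<Rightarrow> nat \<Rightarrow> real \<Rightarrow> real \<Rightarrow> bool" where
  "cmb_distributed M W d r \<nu> \<longleftrightarrow>
     prob_space M \<and> W \<in> measurable M (count_space {0..d}) \<and>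
     (\<forall>k\<in>{0..d}. measure M {\<omega> \<in> space M. W \<omega> = k} = cmb_weight d r \<nu> k / cmb_norm d r \<nu>)"

(* {0,1}^d, with coordinates 1, ..., d; outside {1..d} the functions take the value undefined,
   so that equality of vectors is equality of functions. *)
definition cube :: "nat \<Rightarrow> (nat \<Rightarrow> nat) set" where
  "cube d = {1..d} \<rightarrow>\<^sub>E {0, 1}"

definition bernoulli_vector :: "nat \<Rightarrow> 'a measure \<Rightarrow> ('a \<Rightarrow> nat \<Rightarrow> nat) \<Rightarrow> bool" where
  "bernoulli_vector d M I \<longleftrightarrow> prob_space M \<and> I \<in> measurable M (count_space (cube d))"

definition vec_law :: "nat \<Rightarrow> 'a measure \<Rightarrow> ('a \<Rightarrow> nat \<Rightarrow> nat) \<Rightarrow> (nat \<Rightarrow> nat) measure" where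
  "vec_law d M I = distr M (count_space (cube d)) I"

definition exchangeable :: "nat \<Rightarrow> 'a measure \<Rightarrow> ('a \<Rightarrow> nat \<Rightarrow> nat) \<Rightarrow> bool" where
  "exchangeable d M I \<longleftrightarrow>
     (\<forall>\<pi>. \<pi> permutes {1..d} \<longrightarrow> vec_law d M (\<lambda>\<omega> j. I \<omega> (\<pi> j)) = vec_law d M I)"

definition frechet_class :: "nat \<Rightarrow> real \<Rightarrow> (nat \<Rightarrow> nat) measure set" where
  "frechet_class d p =
     {D. prob_space D \<and> sets D = sets (count_space (cube d)) \<and>
         (\<forall>j\<in>{1..d}. integral\<^sup>L D (\<lambda>i. real (i j)) = p)}"

(* inf and sup on functions are pointwise, hence componentwise minimum and maximum; both leave
   cube d invariant. *)
definition supermodular :: "nat \<Rightarrow> ((nat \<Rightarrow> nat) \<Rightarrow> real) \<Rightarrow> bool" where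
  "supermodular d \<phi> \<longleftrightarrow>
     (\<forall>i\<in>cube d. \<forall>k\<in>cube d. \<phi> i + \<phi> k \<le> \<phi> (inf i k) + \<phi> (sup i k))"

definition sm_le ::
    "nat \<Rightarrow> 'a measure \<Rightarrow> ('a \<Rightarrow> nat \<Rightarrow> nat) \<Rightarrow> 'b measure \<Rightarrow> ('b \<Rightarrow> nat \<Rightarrow> nat) \<Rightarrow> bool" where
  "sm_le d M I N K \<longleftrightarrow>
     (\<forall>\<phi>. supermodular d \<phi> \<longrightarrow> integral\<^sup>L M (\<lambda>\<omega>. \<phi> (I \<omega>)) \<le> integral\<^sup>L N (\<lambda>\<omega>. \<phi> (K \<omega>)))"

end

(* The log-ratio of the two CMB probability functions is (nu2 - nu1) times the convex sequence
   - ln (d choose k), plus an affine term. Hence the difference of the probability functions has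
   sign pattern +, -, +, and equality of the means gives convex order of the two sums.
   By exchangeability E phi(I) = E h(sum I), where h k is the average of phi (e_k o pi) over all
   permutations pi, with e_k the vector of k ones followed by zeros. Composing pi with the transposition
   of k+1 and k+2 turns supermodularity of phi into convexity of h. *)

theory Submission
  imports Defs
begin

section \<open>Convex sequences on \<open>{0..d}\<close> and sign changes\<close>

text \<open>Convexity is imposed only at indices up to \<open>d\<close>, so it is vacuous for
  \<open>d \<le> 1\<close>.\<close>

definition discrete_convex :: "nat \<Rightarrow> (nat \<Rightarrow> real) \<Rightarrow> bool" where
  "discrete_convex d h \<longleftrightarrow> (\<forall>k. Suc (Suc k) \<le> d \<longrightarrow> 2 * h (Suc k) \<le> h k + h (Suc (Suc k)))"

lemma discrete_convex_increment_mono: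
  assumes h: "discrete_convex d h" and "i \<le> j" "j < d"
  shows "h (Suc i) - h i \<le> h (Suc j) - h j"
  using assms(2,3)
proof (induction j rule: dec_induct)
  case base
  then show ?case by simp
next
  case (step n)
  have "2 * h (Suc n) \<le> h n + h (Suc (Suc n))"
    using h step unfolding discrete_convex_def by simp
  with step show ?case by simp
qed

text \<open>Telescope the increments starting at \<open>j\<close>: those to the right are at least
  the forward increment at \<open>j\<close>, those to the left at most. The condition
  \<open>j < d\<close> keeps this increment inside \<open>{0..d}\<close>.\<close>

lemma discrete_convex_subgradient:
  assumes h: "discrete_convex d h" and "j < d" "n \<le> d"
  shows "h j + (real n - real j) * (h (Suc j) - h j) \<le> h n"
proof (cases "j \<le> n")
  case True
  then show ?thesis using assms(3)
  proof (induction n rule: dec_induct)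
    case base
    then show ?case by simp
  next
    case (step n)
    have "h (Suc j) - h j \<le> h (Suc n) - h n"
      using discrete_convex_increment_mono[OF h, of j n] step by simp
    with step show ?case by (simp add: algebra_simps)
  qed
next
  case False
  then have "n \<le> j" by simp
  then show ?thesis
  proof (induction n rule: inc_induct)
    case base
    then show ?case by simp
  next
    case (step n)
    have "h (Suc n) - h n \<le> h (Suc j) - h j"
      using discrete_convex_increment_mono[OF h, of n j] step assms(2) by simp
    with step show ?case by (simp add: algebra_simps)
  qed
qed

text \<open>Weight the subgradient inequalities at \<open>j\<close>, taken towards \<open>i\<close>
  and towards \<open>k\<close>, so that the slope terms cancel. The form without division allows
  indices to coincide.\<close>

lemma discrete_convex_chord:
  assumes h: "discrete_convex d h" and "i \<le> j" "j \<le> k" "k \<le> d"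
  shows "(real k - real i) * h j \<le> (real k - real j) * h i + (real j - real i) * h k"
proof (cases "j < k")
  case True
  define D where "D = h (Suc j) - h j"
  have "h j + (real i - real j) * D \<le> h i" "h j + (real k - real j) * D \<le> h k"
    unfolding D_def by (rule discrete_convex_subgradient[OF h]; use True assms in simp)+
  then have "(real k - real j) * (h j + (real i - real j) * D)
      + (real j - real i) * (h j + (real k - real j) * D)
      \<le> (real k - real j) * h i + (real j - real i) * h k"
    using assms by (intro add_mono mult_left_mono) auto
  moreover have "(real k - real j) * (h j + (real i - real j) * D)
      + (real j - real i) * (h j + (real k - real j) * D) = (real k - real i) * h j"
    by (simp add: algebra_simps)
  ultimately show ?thesis by simp
next
  case False
  then have "j = k" using assms by simp
  then show ?thesis by simp
qed

text \<open>Karlin-Novikoff cut criterion: subtract from \<open>h\<close> its chord over \<open>[a, b]\<close>, which integrates to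
  zero against \<open>q\<close>; the difference then has the sign of \<open>q\<close> everywhere.\<close>

lemma sum_convex_nonneg_of_cut:
  fixes q h :: "nat \<Rightarrow> real"
  assumes h: "discrete_convex d h" and ab: "a < b" "b \<le> d"
    and inside: "\<And>k. a < k \<Longrightarrow> k < b \<Longrightarrow> q k \<le> 0"
    and outside: "\<And>k. k \<le> d \<Longrightarrow> k < a \<or> b < k \<Longrightarrow> 0 \<le> q k"
    and mass: "(\<Sum>k=0..d. q k) = 0" and mean: "(\<Sum>k=0..d. real k * q k) = 0"
  shows "0 \<le> (\<Sum>k=0..d. h k * q k)"
proof -
  define u where "u k = (real b - real a) * h k - ((real b - real k) * h a + (real k - real a) * h b)" for k
  have "0 \<le> u k * q k" if "k \<le> d" for k
  proof -
    consider "k < a" | "k = a \<or> k = b" | "a < k" "k < b" | "b < k" by linarith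
    then show ?thesis
    proof cases
      case 1
      \<comment> \<open>Outside \<open>[a, b]\<close> the sequence lies above the extended chord:
        this is the chord inequality with the endpoint \<open>a\<close> (below, \<open>b\<close>) as
        the middle index, rearranged.\<close>
      have "0 \<le> u k"
        using discrete_convex_chord[OF h, of k a b] 1 ab unfolding u_def by (simp add: algebra_simps)
      then show ?thesis using outside that 1 by simp
    next
      case 2
      then have "u k = 0" by (auto simp: u_def algebra_simps)
      then show ?thesis by simp
    next
      case 3
      have "u k \<le> 0"
        using discrete_convex_chord[OF h, of a k b] 3 ab unfolding u_def by (simp add: algebra_simps)
      then show ?thesis using inside[OF 3] by (simp add: mult_nonpos_nonpos)
    next
      case 4
      have "0 \<le> u k"
        using discrete_convex_chord[OF h, of a b k] 4 ab that unfolding u_def by (simp add: algebra_simps)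
      then show ?thesis using outside that 4 by simp
    qed
  qed
  then have "0 \<le> (\<Sum>k=0..d. u k * q k)" by (intro sum_nonneg) auto
  also have "\<dots> = (\<Sum>k=0..d. (real b - real a) * (h k * q k)
      - (real b * h a - real a * h b) * q k - (h b - h a) * (real k * q k))"
    by (intro sum.cong) (auto simp: u_def algebra_simps)
  also have "\<dots> = (real b - real a) * (\<Sum>k=0..d. h k * q k)"
    by (simp add: sum_subtractf mass mean flip: sum_distrib_left)
  finally show ?thesis using ab by (simp add: zero_le_mult_iff)
qed

text \<open>A convex sequence is negative on an interval of indices, whose endpoints serve as
  \<open>a\<close> and \<open>b\<close>. No sign is claimed at \<open>a\<close> and \<open>b\<close>
  themselves, which leaves room to arrange \<open>a < b\<close> even when fewer than two values are
  negative.\<close>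

lemma discrete_convex_cut:
  assumes L: "discrete_convex d L" and "d \<ge> 1"
  obtains a b where "a < b" "b \<le> d" "\<And>k. a < k \<Longrightarrow> k < b \<Longrightarrow> L k \<le> 0"
    "\<And>k. k \<le> d \<Longrightarrow> k < a \<or> b < k \<Longrightarrow> 0 \<le> L k"
proof -
  define A where "A = {k. k \<le> d \<and> L k < 0}"
  have fin: "finite A" unfolding A_def by simp
  show thesis
  proof (cases "A = {}")
    case True
    then show thesis using that[of 0 1] assms(2) by (force simp: A_def)
  next
    case False
    define a b where "a = Min A" and "b = Max A"
    have "a \<in> A" "b \<in> A" using fin False by (auto simp: a_def b_def)
    then have neg: "L a < 0" "L b < 0" "b \<le> d" by (auto simp: A_def)
    have le: "a \<le> b" using fin False by (auto simp: a_def b_def)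
    have out: "0 \<le> L k" if "k \<le> d" "k < a \<or> b < k" for k
    proof (rule ccontr)
      assume "\<not> 0 \<le> L k"
      then have "k \<in> A" using that by (simp add: A_def)
      then have "a \<le> k" "k \<le> b" using fin by (auto simp: a_def b_def)
      with that show False by simp
    qed
    show thesis
    proof (cases "a < b")
      case True
      have "L k \<le> 0" if k: "a < k" "k < b" for k
      proof -
        have "(real b - real a) * L k \<le> (real b - real k) * L a + (real k - real a) * L b"
          using discrete_convex_chord[OF L, of a k b] k neg by simp
        also have "\<dots> \<le> 0"
          using k neg by (intro add_nonpos_nonpos mult_nonneg_nonpos) auto
        finally show ?thesis using True by (simp add: mult_le_0_iff)
      qed
      then show thesis using that[OF True neg(3)] out by blast
    next
      case False
      then have ab: "a = b" using le by simp
      \<comment> \<open>A single negative value: pair its index with a neighbour that stays inside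
        \<open>{0..d}\<close>.\<close>
      show thesis
      proof (cases "b < d")
        case True
        then show thesis using that[of b "Suc b"] out ab by force
      next
        case False
        then have "b = d" using neg by simp
        then show thesis using that[of "d - 1" d] out ab assms(2) by force
      qed
    qed
  qed
qed

section \<open>Log-concavity of binomial coefficients\<close>

text \<open>The successive ratios \<open>(d - k) / (k + 1)\<close> decrease in \<open>k\<close>. The
  proof multiplies two consecutive recurrences and compares the coefficients of \<open>x * z\<close>
  and \<open>y\<^sup>2\<close>; for \<open>k \<ge> d\<close> the left side is zero.\<close>

lemma binomial_log_concave:
  "(d choose k) * (d choose Suc (Suc k)) \<le> (d choose Suc k)\<^sup>2"
proof (cases "k < d")
  case True
  have ratio: "real (Suc j) * real (d choose Suc j) = (real d - real j) * real (d choose j)"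
    if "j \<le> d" for j
  proof -
    have "Suc j * (d choose Suc j) = (d - j) * (d choose j)"
      using binomial_absorption[of j d] binomial_absorb_comp[of d j] by simp
    then show ?thesis using that by (metis of_nat_diff of_nat_mult)
  qed
  define x y z where "x = real (d choose k)" and "y = real (d choose Suc k)"
    and "z = real (d choose Suc (Suc k))"
  have xy: "real (Suc k) * y = (real d - real k) * x"
    using ratio[of k] True by (simp add: x_def y_def)
  have yz: "real (Suc (Suc k)) * z = (real d - real (Suc k)) * y"
    using ratio[of "Suc k"] True by (simp add: z_def y_def)
  have "((real d - real k) * real (Suc (Suc k))) * (x * z)
      = ((real d - real k) * x) * (real (Suc (Suc k)) * z)" by (simp only: ac_simps)
  also have "\<dots> = (real (Suc k) * (real d - real (Suc k))) * y\<^sup>2"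
    unfolding yz xy[symmetric] by (simp only: ac_simps power2_eq_square)
  also have "\<dots> \<le> ((real d - real k) * real (Suc (Suc k))) * y\<^sup>2"
    using True by (intro mult_right_mono) (auto simp: algebra_simps)
  finally have "x * z \<le> y\<^sup>2" using True by (simp add: mult_le_cancel_left)
  then have "real ((d choose k) * (d choose Suc (Suc k))) \<le> real ((d choose Suc k)\<^sup>2)"
    by (simp add: x_def y_def z_def)
  then show ?thesis by (simp only: of_nat_le_iff)
qed (simp add: binomial_eq_0)

lemma discrete_convex_neg_ln_binomial:
  "discrete_convex d (\<lambda>k. - ln (real (d choose k)))"
  unfolding discrete_convex_def
proof (intro allI impI)
  fix k assume k: "Suc (Suc k) \<le> d"
  then have pos: "0 < real (d choose k)" "0 < real (d choose Suc k)"
    "0 < real (d choose Suc (Suc k))" by simp_all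
  have "real (d choose k) * real (d choose Suc (Suc k)) \<le> (real (d choose Suc k))\<^sup>2"
    using binomial_log_concave[of d k] by (metis of_nat_le_iff of_nat_mult of_nat_power)
  then have "ln (real (d choose k) * real (d choose Suc (Suc k))) \<le> ln ((real (d choose Suc k))\<^sup>2)"
    using pos by (subst ln_le_cancel_iff) auto
  then show "2 * - ln (real (d choose Suc k))
      \<le> - ln (real (d choose k)) + - ln (real (d choose Suc (Suc k)))"
    using pos by (simp add: ln_mult ln_realpow)
qed

section \<open>Convex order of two CMB laws with equal means\<close>

lemma cmb_weight_pos:
  assumes "r \<in> {0<..<1}" "k \<le> d"
  shows "0 < cmb_weight d r \<nu> k"
  using assms by (auto simp: cmb_weight_def)

lemma cmb_norm_pos:
  assumes "r \<in> {0<..<1}"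
  shows "0 < cmb_norm d r \<nu>"
  unfolding cmb_norm_def using assms by (intro sum_pos) (auto intro: cmb_weight_pos)

text \<open>Only the binomial term fails to be affine in \<open>k\<close>, and it carries the factor
  \<open>\<nu>\<close>.\<close>

lemma ln_cmb_weight:
  assumes "r \<in> {0<..<1}" "k \<le> d"
  shows "ln (cmb_weight d r \<nu> k)
    = \<nu> * ln (real (d choose k)) + real k * ln r + (real d - real k) * ln (1 - r)"
  using assms by (auto simp: cmb_weight_def ln_mult ln_powr ln_realpow of_nat_diff)

text \<open>Since \<open>\<nu>2 - \<nu>1\<close> is nonnegative, the log-ratio \<open>L\<close> of
  \<open>f1\<close> to \<open>f2\<close> is convex. Its signs are those of \<open>f1 - f2\<close>,
  so the cut criterion applies: normalization makes the total mass of the difference zero, and the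
  equal means make its first moment zero.\<close>

lemma cmb_convex_order:
  assumes d: "d \<ge> 1" and r: "r1 \<in> {0<..<1}" "r2 \<in> {0<..<1}" and \<nu>: "\<nu>1 \<le> \<nu>2"
    and h: "discrete_convex d h"
    and mean: "(\<Sum>k=0..d. real k * (cmb_weight d r1 \<nu>1 k / cmb_norm d r1 \<nu>1))
      = (\<Sum>k=0..d. real k * (cmb_weight d r2 \<nu>2 k / cmb_norm d r2 \<nu>2))"
  shows "(\<Sum>k=0..d. h k * (cmb_weight d r2 \<nu>2 k / cmb_norm d r2 \<nu>2))
    \<le> (\<Sum>k=0..d. h k * (cmb_weight d r1 \<nu>1 k / cmb_norm d r1 \<nu>1))"
proof -
  define f1 f2 where "f1 k = cmb_weight d r1 \<nu>1 k / cmb_norm d r1 \<nu>1"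
    and "f2 k = cmb_weight d r2 \<nu>2 k / cmb_norm d r2 \<nu>2" for k
  have pos: "0 < f1 k" "0 < f2 k" if "k \<le> d" for k
    using that r by (simp_all add: f1_def f2_def cmb_weight_pos cmb_norm_pos)
  have norm: "(\<Sum>k=0..d. f1 k) = 1" "(\<Sum>k=0..d. f2 k) = 1"
    using cmb_norm_pos[OF r(1), of d \<nu>1] cmb_norm_pos[OF r(2), of d \<nu>2]
    by (simp_all add: f1_def f2_def cmb_norm_def flip: sum_divide_distrib)
  define L where "L k = ln (f1 k) - ln (f2 k)" for k
  \<comment> \<open>The affine part of \<open>L\<close>: \<open>A\<close> is the difference of the
    log-odds of \<open>r1\<close> and \<open>r2\<close>, and \<open>B\<close> collects the terms
    free of \<open>k\<close>, including the normalizing constants.\<close>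
  define A B where "A = ln r1 - ln (1 - r1) - ln r2 + ln (1 - r2)"
    and "B = real d * (ln (1 - r1) - ln (1 - r2)) - ln (cmb_norm d r1 \<nu>1) + ln (cmb_norm d r2 \<nu>2)"
  have L_eq: "L k = (\<nu>2 - \<nu>1) * - ln (real (d choose k)) + A * real k + B" if "k \<le> d" for k
    using that r cmb_norm_pos[OF r(1), of d \<nu>1] cmb_norm_pos[OF r(2), of d \<nu>2]
      cmb_weight_pos[OF r(1) that, of \<nu>1] cmb_weight_pos[OF r(2) that, of \<nu>2]
    by (simp add: L_def f1_def f2_def ln_div ln_cmb_weight A_def B_def algebra_simps)
  have "discrete_convex d L"
    unfolding discrete_convex_def
  proof (intro allI impI)
    fix k assume k: "Suc (Suc k) \<le> d"
    have "(\<nu>2 - \<nu>1) * (2 * - ln (real (d choose Suc k)))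
        \<le> (\<nu>2 - \<nu>1) * (- ln (real (d choose k)) + - ln (real (d choose Suc (Suc k))))"
      using discrete_convex_neg_ln_binomial[of d] k \<nu>
      unfolding discrete_convex_def by (intro mult_left_mono) auto
    then show "2 * L (Suc k) \<le> L k + L (Suc (Suc k))"
      using k by (simp add: L_eq algebra_simps)
  qed
  then obtain a b where ab: "a < b" "b \<le> d"
    and inside: "\<And>k. a < k \<Longrightarrow> k < b \<Longrightarrow> L k \<le> 0"
    and outside: "\<And>k. k \<le> d \<Longrightarrow> k < a \<or> b < k \<Longrightarrow> 0 \<le> L k"
    using discrete_convex_cut[OF _ d] by blast
  have "0 \<le> (\<Sum>k=0..d. h k * (f1 k - f2 k))"
  proof (rule sum_convex_nonneg_of_cut[OF h ab])
    show "f1 k - f2 k \<le> 0" if "a < k" "k < b" for k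
      using inside[OF that] pos[of k] that ab by (simp add: L_def)
    show "0 \<le> f1 k - f2 k" if "k \<le> d" "k < a \<or> b < k" for k
      using outside[OF that] pos[OF that(1)] by (simp add: L_def)
    show "(\<Sum>k=0..d. f1 k - f2 k) = 0"
      by (simp add: sum_subtractf norm)
    show "(\<Sum>k=0..d. real k * (f1 k - f2 k)) = 0"
      using mean by (simp add: f1_def f2_def sum_subtractf right_diff_distrib)
  qed
  then show ?thesis
    by (simp add: f1_def f2_def sum_subtractf right_diff_distrib)
qed

section \<open>Symmetrization of supermodular functions\<close>

text \<open>The restricted abstraction yields \<open>undefined\<close> outside
  \<open>{1..d}\<close>, as membership in \<open>cube d\<close> demands.\<close>

definition initial_vector :: "nat \<Rightarrow> nat \<Rightarrow> nat \<Rightarrow> nat" where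
  "initial_vector d k = (\<lambda>j\<in>{1..d}. of_bool (j \<le> k))"

text \<open>For \<open>k \<le> d\<close> this is the uniform mean of \<open>\<phi>\<close> over the
  vectors with exactly \<open>k\<close> ones, since each of them arises from equally many
  permutations.\<close>

definition symmetrization :: "nat \<Rightarrow> ((nat \<Rightarrow> nat) \<Rightarrow> real) \<Rightarrow> nat \<Rightarrow> real" where
  "symmetrization d \<phi> k = (\<Sum>\<pi> | \<pi> permutes {1..d}. \<phi> (initial_vector d k \<circ> \<pi>)) / fact d"

lemma finite_cube: "finite (cube d)"
  unfolding cube_def by (intro finite_PiE) auto

lemma cube_comp_permutes:
  assumes "x \<in> cube d" "\<pi> permutes {1..d}"
  shows "x \<circ> \<pi> \<in> cube d"
  using assms permutes_in_image[OF assms(2)]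
  by (fastforce simp: cube_def PiE_iff extensional_def)

lemma initial_vector_in_cube: "initial_vector d k \<in> cube d"
  by (auto simp: initial_vector_def cube_def)

lemma sum_cube_le:
  assumes "x \<in> cube d"
  shows "(\<Sum>j=1..d. x j) \<le> d"
proof -
  have "x j \<le> 1" if "j \<in> {1..d}" for j
    using assms that by (auto simp: cube_def dest: PiE_mem)
  then have "(\<Sum>j=1..d. x j) \<le> (\<Sum>j=1..d. 1)" by (intro sum_mono)
  then show ?thesis by simp
qed

text \<open>Composing with \<open>\<tau>\<close> moves the last one of the initial vector from
  position \<open>k + 1\<close> to \<open>k + 2\<close>. The meet of the old and the new vector has
  ones exactly up to \<open>k\<close>, their join exactly up to \<open>k + 2\<close>; rearranging by
  \<open>\<pi>\<close> respects both operations.\<close>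

lemma supermodular_diamond:
  assumes \<phi>: "supermodular d \<phi>" and \<pi>: "\<pi> permutes {1..d}" and k: "Suc (Suc k) \<le> d"
  defines "\<tau> \<equiv> Transposition.transpose (Suc k) (Suc (Suc k))"
  shows "\<phi> (initial_vector d (Suc k) \<circ> \<pi>) + \<phi> (initial_vector d (Suc k) \<circ> (\<tau> \<circ> \<pi>))
    \<le> \<phi> (initial_vector d k \<circ> \<pi>) + \<phi> (initial_vector d (Suc (Suc k)) \<circ> \<pi>)"
proof -
  have \<tau>: "\<tau> permutes {1..d}" unfolding \<tau>_def using k by (intro permutes_swap_id) auto
  let ?x = "initial_vector d (Suc k)"
  have inf: "inf (?x \<circ> \<pi>) (?x \<circ> (\<tau> \<circ> \<pi>)) = initial_vector d k \<circ> \<pi>"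
    and sup: "sup (?x \<circ> \<pi>) (?x \<circ> (\<tau> \<circ> \<pi>)) = initial_vector d (Suc (Suc k)) \<circ> \<pi>"
    using k by (auto simp: fun_eq_iff initial_vector_def \<tau>_def Transposition.transpose_def inf_min sup_max)
  have "?x \<circ> \<pi> \<in> cube d" "?x \<circ> (\<tau> \<circ> \<pi>) \<in> cube d"
    using permutes_compose[OF \<pi> \<tau>] \<pi> by (auto intro: cube_comp_permutes initial_vector_in_cube)
  then have "\<phi> (?x \<circ> \<pi>) + \<phi> (?x \<circ> (\<tau> \<circ> \<pi>))
      \<le> \<phi> (inf (?x \<circ> \<pi>) (?x \<circ> (\<tau> \<circ> \<pi>))) + \<phi> (sup (?x \<circ> \<pi>) (?x \<circ> (\<tau> \<circ> \<pi>)))"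
    using \<phi> unfolding supermodular_def by blast
  then show ?thesis unfolding inf sup .
qed

lemma discrete_convex_symmetrization:
  assumes \<phi>: "supermodular d \<phi>"
  shows "discrete_convex d (symmetrization d \<phi>)"
  unfolding discrete_convex_def
proof (intro allI impI)
  fix k assume k: "Suc (Suc k) \<le> d"
  define \<tau> where "\<tau> = Transposition.transpose (Suc k) (Suc (Suc k))"
  have \<tau>: "\<tau> permutes {1..d}" unfolding \<tau>_def using k by (intro permutes_swap_id) auto
  define s where "s m = (\<Sum>\<pi> | \<pi> permutes {1..d}. \<phi> (initial_vector d m \<circ> \<pi>))" for m
  \<comment> \<open>Left composition with \<open>\<tau>\<close> permutes the summation range, so the
    swapped vectors also sum to \<open>s (Suc k)\<close>; the diamond inequality can then be summed
    over all \<open>\<pi>\<close>.\<close>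
  have "2 * s (Suc k) = s (Suc k)
      + (\<Sum>\<pi> | \<pi> permutes {1..d}. \<phi> (initial_vector d (Suc k) \<circ> (\<tau> \<circ> \<pi>)))"
    unfolding s_def
    using setum_permutations_compose_left[OF \<tau>, of "\<lambda>\<pi>. \<phi> (initial_vector d (Suc k) \<circ> \<pi>)"]
      by simp
  also have "\<dots> \<le> s k + s (Suc (Suc k))"
    unfolding s_def sum.distrib[symmetric] \<tau>_def
    by (intro sum_mono supermodular_diamond[OF \<phi> _ k]) simp
  finally have "2 * s (Suc k) / fact d \<le> (s k + s (Suc (Suc k))) / fact d"
    by (intro divide_right_mono) auto
  then show "2 * symmetrization d \<phi> (Suc k)
      \<le> symmetrization d \<phi> k + symmetrization d \<phi> (Suc (Suc k))"
    by (simp add: symmetrization_def s_def add_divide_distrib)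
qed

text \<open>Glue \<open>\<sigma>\<close> from a bijection of the positions of the ones onto
  \<open>{1..k}\<close> and a bijection of the remaining positions onto \<open>{Suc k..d}\<close>,
  where \<open>k\<close> is the number of ones.\<close>

lemma cube_permutes_initial_vector:
  assumes x: "x \<in> cube d"
  obtains \<sigma> where "\<sigma> permutes {1..d}" "x = initial_vector d (\<Sum>j=1..d. x j) \<circ> \<sigma>"
proof -
  define A where "A = {j\<in>{1..d}. x j = 1}"
  define k where "k = (\<Sum>j=1..d. x j)"
  have x01: "x j = of_bool (j \<in> A)" if "j \<in> {1..d}" for j
    using that x by (auto simp: A_def cube_def PiE_iff)
  have AS: "A \<subseteq> {1..d}" by (auto simp: A_def)
  have "k = card A"
  proof -
    have "k = (\<Sum>j\<in>{1..d}. of_bool (j \<in> A))"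
      unfolding k_def by (intro sum.cong refl x01)
    also have "\<dots> = card ({1..d} \<inter> A)" by simp
    also have "{1..d} \<inter> A = A" using AS by blast
    finally show ?thesis .
  qed
  have kd: "k \<le> d" using sum_cube_le[OF x] by (simp add: k_def)
  have "card A = card {1..k}" using \<open>k = card A\<close> by simp
  then obtain f where f: "bij_betw f A {1..k}"
    using AS by (metis finite_atLeastAtMost finite_subset finite_same_card_bij)
  have "card ({1..d} - A) = card {Suc k..d}"
    using \<open>k = card A\<close> AS by (simp add: card_Diff_subset finite_subset)
  then obtain g where g: "bij_betw g ({1..d} - A) {Suc k..d}"
    by (metis finite_atLeastAtMost finite_Diff finite_same_card_bij)
  define \<sigma> where "\<sigma> j = (if j \<in> A then f j else if j \<in> {1..d} then g j else j)" for j
  have fA: "bij_betw \<sigma> A {1..k}"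
    using f by (rule bij_betw_cong[THEN iffD1, rotated]) (simp add: \<sigma>_def)
  have gA: "bij_betw \<sigma> ({1..d} - A) {Suc k..d}"
    using g by (rule bij_betw_cong[THEN iffD1, rotated]) (simp add: \<sigma>_def)
  have "bij_betw \<sigma> (A \<union> ({1..d} - A)) ({1..k} \<union> {Suc k..d})"
    using fA gA by (rule bij_betw_combine) auto
  moreover have "A \<union> ({1..d} - A) = {1..d}" "{1..k} \<union> {Suc k..d} = {1..d}"
    using AS kd by auto
  ultimately have "bij_betw \<sigma> {1..d} {1..d}" by simp
  then have perm: "\<sigma> permutes {1..d}"
    by (rule bij_imp_permutes) (use AS in \<open>auto simp: \<sigma>_def\<close>)
  have "x j = initial_vector d k (\<sigma> j)" for j
  proof (cases "j \<in> {1..d}")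
    case True
    then have "\<sigma> j \<in> {1..d}" using permutes_in_image[OF perm] by simp
    moreover have "\<sigma> j \<le> k \<longleftrightarrow> j \<in> A"
    proof (cases "j \<in> A")
      case True
      then show ?thesis using bij_betwE[OF fA] by simp
    next
      case False
      with \<open>j \<in> {1..d}\<close> have "\<sigma> j \<in> {Suc k..d}" using bij_betwE[OF gA] by blast
      with False show ?thesis by simp
    qed
    ultimately show ?thesis using x01[OF True] by (simp add: initial_vector_def)
  next
    case False
    \<comment> \<open>Outside \<open>{1..d}\<close> both sides are \<open>undefined\<close>, because
      \<open>\<sigma>\<close> fixes \<open>j\<close>.\<close>
    then have "\<sigma> j = j" using perm by (simp add: permutes_not_in)
    then show ?thesis using False x
      by (auto simp: initial_vector_def cube_def PiE_iff extensional_def)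
  qed
  then have "x = initial_vector d k \<circ> \<sigma>" by (simp add: fun_eq_iff)
  then show thesis unfolding k_def by (rule that[OF perm])
qed

text \<open>Write \<open>x\<close> as a rearranged initial vector; reindexing the permutations by
  left composition absorbs the rearrangement, so the sum sees only the number of ones.\<close>

lemma sum_permutes_eq_symmetrization:
  assumes "x \<in> cube d"
  shows "(\<Sum>\<pi> | \<pi> permutes {1..d}. \<phi> (x \<circ> \<pi>)) = fact d * symmetrization d \<phi> (\<Sum>j=1..d. x j)"
proof -
  define k where "k = (\<Sum>j=1..d. x j)"
  obtain \<sigma> where \<sigma>: "\<sigma> permutes {1..d}" and x: "x = initial_vector d k \<circ> \<sigma>"
    using cube_permutes_initial_vector[OF assms] unfolding k_def by blast
  have "(\<Sum>\<pi> | \<pi> permutes {1..d}. \<phi> (x \<circ> \<pi>))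
      = (\<Sum>\<pi> | \<pi> permutes {1..d}. \<phi> (initial_vector d k \<circ> \<pi>))"
    using setum_permutations_compose_left[OF \<sigma>, of "\<lambda>\<pi>. \<phi> (initial_vector d k \<circ> \<pi>)"]
    by (simp add: x comp_assoc)
  then show ?thesis by (simp add: symmetrization_def k_def)
qed

section \<open>Expectations under exchangeable Bernoulli laws and CMB laws\<close>

lemma bernoulli_vectorD:
  assumes "bernoulli_vector d M I"
  shows "prob_space M" and "I \<in> measurable M (count_space (cube d))"
    and "\<And>\<omega>. \<omega> \<in> space M \<Longrightarrow> I \<omega> \<in> cube d"
  using assms measurable_space[of I M "count_space (cube d)"] by (auto simp: bernoulli_vector_def)

lemma measurable_bernoulli_vector_fun:
  assumes "bernoulli_vector d M I" "\<And>x. x \<in> cube d \<Longrightarrow> f x \<in> space N"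
  shows "(\<lambda>\<omega>. f (I \<omega>)) \<in> measurable M N"
proof -
  have "f \<in> measurable (count_space (cube d)) N" using assms(2) by simp
  then show ?thesis using measurable_compose bernoulli_vectorD(2)[OF assms(1)] by blast
qed

text \<open>The cube is finite, so \<open>f\<close> is bounded on it, and bounded measurable
  functions are integrable under a probability measure.\<close>

lemma integrable_bernoulli_vector_fun:
  fixes f :: "(nat \<Rightarrow> nat) \<Rightarrow> real"
  assumes I: "bernoulli_vector d M I"
  shows "integrable M (\<lambda>\<omega>. f (I \<omega>))"
proof -
  interpret prob_space M using bernoulli_vectorD(1)[OF I] .
  have "finite ((\<lambda>x. \<bar>f x\<bar>) ` cube d)" using finite_cube by simp
  then have "\<bar>f x\<bar> \<le> Max ((\<lambda>x. \<bar>f x\<bar>) ` cube d)" if "x \<in> cube d" for x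
    using that by (intro Max_ge) auto
  then show ?thesis
    using bernoulli_vectorD(3)[OF I] measurable_bernoulli_vector_fun[OF I, of f borel]
    by (intro integrable_const_bound[where B = "Max ((\<lambda>x. \<bar>f x\<bar>) ` cube d)"]) auto
qed

lemma integral_vec_law:
  fixes f :: "(nat \<Rightarrow> nat) \<Rightarrow> real"
  assumes "bernoulli_vector d M I"
  shows "integral\<^sup>L (vec_law d M I) f = integral\<^sup>L M (\<lambda>\<omega>. f (I \<omega>))"
  unfolding vec_law_def using bernoulli_vectorD(2)[OF assms] by (intro integral_distr) auto

lemma integral_exchangeable:
  fixes f :: "(nat \<Rightarrow> nat) \<Rightarrow> real"
  assumes I: "bernoulli_vector d M I" and ex: "exchangeable d M I" and \<pi>: "\<pi> permutes {1..d}"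
  shows "integral\<^sup>L M (\<lambda>\<omega>. f (I \<omega> \<circ> \<pi>)) = integral\<^sup>L M (\<lambda>\<omega>. f (I \<omega>))"
proof -
  have "bernoulli_vector d M (\<lambda>\<omega>. I \<omega> \<circ> \<pi>)"
    using measurable_bernoulli_vector_fun[OF I, of "\<lambda>x. x \<circ> \<pi>" "count_space (cube d)"]
      cube_comp_permutes[OF _ \<pi>] bernoulli_vectorD(1)[OF I]
    by (simp add: bernoulli_vector_def)
  moreover have "vec_law d M (\<lambda>\<omega>. I \<omega> \<circ> \<pi>) = vec_law d M I"
    using ex \<pi> by (simp add: exchangeable_def comp_def)
  ultimately show ?thesis using integral_vec_law I by metis
qed

text \<open>All \<open>fact d\<close> rearrangements of the vector give the same expectation of
  \<open>\<phi>\<close>; averaging them inside the integral leaves a function of the number of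
  ones.\<close>

lemma integral_exchangeable_eq_symmetrization:
  assumes I: "bernoulli_vector d M I" and ex: "exchangeable d M I"
  shows "integral\<^sup>L M (\<lambda>\<omega>. \<phi> (I \<omega>)) = integral\<^sup>L M (\<lambda>\<omega>. symmetrization d \<phi> (\<Sum>j=1..d. I \<omega> j))"
proof -
  have "fact d * integral\<^sup>L M (\<lambda>\<omega>. \<phi> (I \<omega>))
      = (\<Sum>\<pi> | \<pi> permutes {1..d}. integral\<^sup>L M (\<lambda>\<omega>. \<phi> (I \<omega> \<circ> \<pi>)))"
    using integral_exchangeable[OF I ex, of _ \<phi>] by (simp add: card_permutations)
  also have "\<dots> = integral\<^sup>L M (\<lambda>\<omega>. \<Sum>\<pi> | \<pi> permutes {1..d}. \<phi> (I \<omega> \<circ> \<pi>))"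
    by (rule Bochner_Integration.integral_sum[symmetric])
      (rule integrable_bernoulli_vector_fun[OF I, of "\<lambda>x. \<phi> (x \<circ> _)"])
  also have "\<dots> = integral\<^sup>L M (\<lambda>\<omega>. fact d * symmetrization d \<phi> (\<Sum>j=1..d. I \<omega> j))"
    by (intro Bochner_Integration.integral_cong refl sum_permutes_eq_symmetrization
        bernoulli_vectorD(3)[OF I])
  finally show ?thesis by simp
qed

lemma integral_sum_bernoulli_vector:
  fixes h :: "nat \<Rightarrow> real"
  assumes I: "bernoulli_vector d M I"
    and W: "W \<in> measurable N (count_space {0..d})"
    and eq: "distr M (count_space {0..d}) (\<lambda>\<omega>. \<Sum>j=1..d. I \<omega> j) = distr N (count_space {0..d}) W"
  shows "integral\<^sup>L M (\<lambda>\<omega>. h (\<Sum>j=1..d. I \<omega> j)) = integral\<^sup>L N (\<lambda>\<omega>. h (W \<omega>))"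
proof -
  have S: "(\<lambda>\<omega>. \<Sum>j=1..d. I \<omega> j) \<in> measurable M (count_space {0..d})"
    by (rule measurable_bernoulli_vector_fun[OF I]) (use sum_cube_le in auto)
  have h: "h \<in> borel_measurable (count_space {0..d})" by simp
  show ?thesis
    using integral_distr[OF S h] integral_distr[OF W h] unfolding eq by (rule trans[OF sym])
qed

text \<open>Expanding \<open>h (W \<omega>)\<close> over the finitely many level sets of
  \<open>W\<close> reduces the integral to point probabilities.\<close>

lemma integral_cmb_distributed:
  fixes h :: "nat \<Rightarrow> real"
  assumes "cmb_distributed N W d r \<nu>"
  shows "integral\<^sup>L N (\<lambda>\<omega>. h (W \<omega>)) = (\<Sum>k=0..d. h k * (cmb_weight d r \<nu> k / cmb_norm d r \<nu>))"
proof -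
  interpret prob_space N using assms by (simp add: cmb_distributed_def)
  have W: "W \<in> measurable N (count_space {0..d})" using assms by (simp add: cmb_distributed_def)
  have sets: "{\<omega> \<in> space N. W \<omega> = k} \<in> sets N" if "k \<in> {0..d}" for k
    using measurable_sets[OF W, of "{k}"] that by (simp add: vimage_def Int_def conj_commute)
  have "integral\<^sup>L N (\<lambda>\<omega>. h (W \<omega>))
      = integral\<^sup>L N (\<lambda>\<omega>. \<Sum>k=0..d. h k * indicator {\<omega> \<in> space N. W \<omega> = k} \<omega>)"
  proof (rule Bochner_Integration.integral_cong[OF refl])
    fix \<omega> assume \<omega>: "\<omega> \<in> space N"
    then have "W \<omega> \<in> {0..d}" using measurable_space[OF W] by simp
    moreover have "(\<Sum>k=0..d. h k * indicator {\<omega> \<in> space N. W \<omega> = k} \<omega>)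
        = (\<Sum>k=0..d. if W \<omega> = k then h k else 0)"
      using \<omega> by (intro sum.cong) (auto simp: indicator_def)
    ultimately show "h (W \<omega>) = (\<Sum>k=0..d. h k * indicator {\<omega> \<in> space N. W \<omega> = k} \<omega>)"
      by simp
  qed
  also have "\<dots> = (\<Sum>k=0..d. integral\<^sup>L N (\<lambda>\<omega>. h k * indicator {\<omega> \<in> space N. W \<omega> = k} \<omega>))"
    using sets by (intro Bochner_Integration.integral_sum) (auto simp: emeasure_eq_measure)
  also have "\<dots> = (\<Sum>k=0..d. h k * measure N {\<omega> \<in> space N. W \<omega> = k})"
  proof -
    have "{\<omega> \<in> space N. W \<omega> = k} \<inter> space N = {\<omega> \<in> space N. W \<omega> = k}" for k by blast
    then show ?thesis by simp
  qed
  also have "\<dots> = (\<Sum>k=0..d. h k * (cmb_weight d r \<nu> k / cmb_norm d r \<nu>))"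
    using assms by (simp add: cmb_distributed_def)
  finally show ?thesis .
qed

section \<open>Marginal means and the supermodular comparison\<close>

text \<open>Transposing two coordinates preserves the law, so all \<open>d\<close> marginal means
  agree, and they add up to \<open>\<mu>\<close>.\<close>

lemma exchangeable_vec_law_in_frechet_class:
  assumes "d \<ge> 1" and I: "bernoulli_vector d M I" and ex: "exchangeable d M I"
    and mean: "integral\<^sup>L M (\<lambda>\<omega>. real (\<Sum>j=1..d. I \<omega> j)) = \<mu>"
  shows "vec_law d M I \<in> frechet_class d (\<mu> / real d)"
proof -
  have "integral\<^sup>L (vec_law d M I) (\<lambda>i. real (i j)) = \<mu> / real d" if j: "j \<in> {1..d}" for j
  proof -
    have "integral\<^sup>L M (\<lambda>\<omega>. real (I \<omega> i)) = integral\<^sup>L M (\<lambda>\<omega>. real (I \<omega> j))" if "i \<in> {1..d}" for i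
      using integral_exchangeable[OF I ex permutes_swap_id[OF that j], of "\<lambda>x. real (x j)"] by simp
    then have "(\<Sum>i=1..d. integral\<^sup>L M (\<lambda>\<omega>. real (I \<omega> i)))
        = real d * integral\<^sup>L M (\<lambda>\<omega>. real (I \<omega> j))"
      by simp
    moreover have "(\<Sum>i=1..d. integral\<^sup>L M (\<lambda>\<omega>. real (I \<omega> i))) = \<mu>"
      unfolding mean[symmetric] of_nat_sum
      by (rule Bochner_Integration.integral_sum[symmetric])
        (rule integrable_bernoulli_vector_fun[OF I, of "\<lambda>x. real (x _)"])
    ultimately show ?thesis
      using assms(1) by (simp add: integral_vec_law[OF I] field_simps)
  qed
  moreover have "prob_space (vec_law d M I)"
    unfolding vec_law_def using bernoulli_vectorD[OF I] by (intro prob_space.prob_space_distr)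
  ultimately show ?thesis by (simp add: frechet_class_def vec_law_def)
qed

theorem corollary3p2:
  fixes d :: nat and r1 r2 \<nu>1 \<nu>2 \<mu> :: real
    and N1 :: "'a measure" and W1 :: "'a \<Rightarrow> nat"
    and N2 :: "'b measure" and W2 :: "'b \<Rightarrow> nat"
    and M1 :: "'c measure" and I1 :: "'c \<Rightarrow> nat \<Rightarrow> nat"
    and M2 :: "'e measure" and I2 :: "'e \<Rightarrow> nat \<Rightarrow> nat"
  assumes "d \<ge> 1"
    and "r1 \<in> {0<..<1}" and "r2 \<in> {0<..<1}"
    and "cmb_distributed N1 W1 d r1 \<nu>1"
    and "cmb_distributed N2 W2 d r2 \<nu>2"
    and "integral\<^sup>L N1 (\<lambda>\<omega>. real (W1 \<omega>)) = \<mu>"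
    and "integral\<^sup>L N2 (\<lambda>\<omega>. real (W2 \<omega>)) = \<mu>"
    and "\<nu>1 \<le> \<nu>2"
    and "bernoulli_vector d M1 I1" and "exchangeable d M1 I1"
    and "bernoulli_vector d M2 I2" and "exchangeable d M2 I2"
    and "distr M1 (count_space {0..d}) (\<lambda>\<omega>. \<Sum>j = 1..d. I1 \<omega> j)
           = distr N1 (count_space {0..d}) W1"
    and "distr M2 (count_space {0..d}) (\<lambda>\<omega>. \<Sum>j = 1..d. I2 \<omega> j)
           = distr N2 (count_space {0..d}) W2"
  shows "vec_law d M1 I1 \<in> frechet_class d (\<mu> / real d)
       \<and> vec_law d M2 I2 \<in> frechet_class d (\<mu> / real d)
       \<and> sm_le d M2 I2 M1 I1"
proof -
  note W = assms(4,5)[unfolded cmb_distributed_def, THEN conjunct2, THEN conjunct1]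
  \<comment> \<open>\<open>E1\<close> and \<open>E2\<close> trade a function of the sum of the
    entries for the same function of \<open>W1\<close> or \<open>W2\<close>: \<open>real\<close> for
    the marginal means, the symmetrization of \<open>\<phi>\<close> for the order.\<close>
  note E1 = integral_sum_bernoulli_vector[OF assms(9) W(1) assms(13)]
  note E2 = integral_sum_bernoulli_vector[OF assms(11) W(2) assms(14)]
  have "vec_law d M1 I1 \<in> frechet_class d (\<mu> / real d)"
    using exchangeable_vec_law_in_frechet_class[OF assms(1,9,10)] E1[of real] assms(6) by simp
  moreover have "vec_law d M2 I2 \<in> frechet_class d (\<mu> / real d)"
    using exchangeable_vec_law_in_frechet_class[OF assms(1,11,12)] E2[of real] assms(7) by simp
  moreover have "sm_le d M2 I2 M1 I1"
    unfolding sm_le_def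
  proof (intro allI impI)
    fix \<phi> assume \<phi>: "supermodular d \<phi>"
    have "integral\<^sup>L M2 (\<lambda>\<omega>. \<phi> (I2 \<omega>))
        = (\<Sum>k=0..d. symmetrization d \<phi> k * (cmb_weight d r2 \<nu>2 k / cmb_norm d r2 \<nu>2))"
      by (simp only: integral_exchangeable_eq_symmetrization[OF assms(11,12)] E2
          integral_cmb_distributed[OF assms(5)])
    \<comment> \<open>The mean condition of \<open>cmb_convex_order\<close> comes from evaluating
      both CMB expectations at the function \<open>real\<close>; both equal
      \<open>\<mu>\<close>.\<close>
    also have "\<dots> \<le> (\<Sum>k=0..d. symmetrization d \<phi> k * (cmb_weight d r1 \<nu>1 k / cmb_norm d r1 \<nu>1))"
      using integral_cmb_distributed[OF assms(4), of real]
        integral_cmb_distributed[OF assms(5), of real] assms(6,7)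
      by (intro cmb_convex_order assms(1-3,8) discrete_convex_symmetrization[OF \<phi>]) simp
    also have "\<dots> = integral\<^sup>L M1 (\<lambda>\<omega>. \<phi> (I1 \<omega>))"
      by (simp only: integral_exchangeable_eq_symmetrization[OF assms(9,10)] E1
          integral_cmb_distributed[OF assms(4)])
    finally show "integral\<^sup>L M2 (\<lambda>\<omega>. \<phi> (I2 \<omega>)) \<le> integral\<^sup>L M1 (\<lambda>\<omega>. \<phi> (I1 \<omega>))" .
  qed
  ultimately show ?thesis by blast
qed

end
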